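(* Let $k$ be any positive integer. Then for every integer $n\ge 0$: (i) $\overline{R}_{5k}^{\ast}(5n+\xi)\equiv 0\pmod 4$ for each $\xi\in\{2,3\}$; (ii) $\overline{R}_{5k}^{\ast}(5n+1)\equiv 0\pmod 2$.
   Context: An overpartition of a nonnegative integer $n$ is a partition of $n$ in which the first occurrence of each part size may be overlined. For a positive integer $\ell$, $\overline{R}_\ell^{\ast}(n)$ denotes the number of overpartitions of $n$ in which the non-overlined parts are $\ell$-regular, i.e. no non-overlined part is divisible by $\ell$ (overlined parts are unrestricted). With $f_h:=\prod_{m\ge 1}(1-q^{hm})$, the generating function is $\sum_{n\ge 0}\overline{R}_\ell^{\ast}(n)q^n=\frac{f_2f_\ell}{f_1^2}$. *)

theory Defs
  imports "HOL-Library.Multiset" "HOL-Number_Theory.Cong"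
begin

text \<open>
  An overpartition is encoded as a pair of a partition \<open>P\<close> (the multiset of all parts, overlined
  or not) and the set \<open>S\<close> of those part sizes whose first occurrence is overlined.
\<close>

definition is_partition :: "nat \<Rightarrow> nat multiset \<Rightarrow> bool" where
  "is_partition n P \<longleftrightarrow> 0 \<notin># P \<and> sum_mset P = n"

definition overpartitions :: "nat \<Rightarrow> (nat multiset \<times> nat set) set" where
  "overpartitions n = {(P, S). is_partition n P \<and> S \<subseteq> set_mset P}"

text \<open>Each size in \<open>S\<close> is overlined exactly once; its further occurrences are non-overlined.\<close>

definition nonoverlined_parts :: "nat multiset \<times> nat set \<Rightarrow> nat multiset" where
  "nonoverlined_parts = (\<lambda>(P, S). P - mset_set S)"

definition regular :: "nat \<Rightarrow> nat multiset \<Rightarrow> bool" where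
  "regular l M \<longleftrightarrow> (\<forall>m\<in>#M. \<not> l dvd m)"

definition Rstar :: "nat \<Rightarrow> nat \<Rightarrow> nat" where
  "Rstar l n = card {p \<in> overpartitions n. regular l (nonoverlined_parts p)}"

text \<open>The cardinality above is that of a finite set, so it is a genuine count.\<close>

lemma size_le_sum_mset:
  fixes P :: "nat multiset"
  assumes "0 \<notin># P"
  shows "size P \<le> sum_mset P"
  using assms by (induction P) (auto simp: Suc_le_eq)

lemma finite_overpartitions: "finite (overpartitions n)"
proof -
  have "overpartitions n \<subseteq>
      mset ` {xs. set xs \<subseteq> {..n} \<and> length xs \<le> n} \<times> Pow {..n}"
  proof (clarsimp simp: overpartitions_def is_partition_def, intro conjI)
    fix P :: "nat multiset" and S
    assume P: "0 \<notin># P" and S: "S \<subseteq> set_mset P"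
    have le: "m \<le> sum_mset P" if "m \<in># P" for m
      using that by (metis le_add1 multi_member_split sum_mset.add_mset)
    obtain xs where xs: "P = mset xs" by (metis ex_mset)
    show "P \<in> mset ` {xs. set xs \<subseteq> {..sum_mset P} \<and> length xs \<le> sum_mset P}"
    proof (rule image_eqI[where x = xs])
      show "P = mset xs" by (fact xs)
      have "length xs \<le> sum_mset P"
        using size_le_sum_mset[OF P] by (metis xs size_mset)
      moreover have "set xs \<subseteq> {..sum_mset P}"
        using le xs by (metis atMost_iff set_mset_mset subsetI)
      ultimately show "xs \<in> {xs. set xs \<subseteq> {..sum_mset P} \<and> length xs \<le> sum_mset P}"
        by blast
    qed
    show "S \<subseteq> {..sum_mset P}" using S le by auto
  qed
  then show ?thesis
    by (rule finite_subset) (simp add: finite_lists_length_le)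
qed

end

theory Submission
  imports Defs
begin

text \<open>
  Fix a partition \<open>P\<close> of \<open>n\<close> and ask in how many ways it can be overlined so that no multiple of
  \<open>l\<close> stays non-overlined. Each multiple of \<open>l\<close> has to occur at most once and its occurrence has
  to be overlined, while every size that is not a multiple of \<open>l\<close> may be overlined or not. So
  \<open>Rstar l n\<close> is the sum of \<open>2 ^ r(P)\<close> over the partitions \<open>P\<close> of \<open>n\<close> whose multiples of \<open>l\<close> are
  distinct, where \<open>r(P)\<close> is the number of sizes not divisible by \<open>l\<close> (\<open>Rstar_eq_sum\<close>).

  If \<open>l\<close> does not divide \<open>n\<close> then \<open>r(P) \<ge> 1\<close> for all such \<open>P\<close>, and the sum is even. Modulo 4 only
  the partitions with \<open>r(P) = 1\<close> survive, each contributing 2. Such a partition consists of a set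
  \<open>D\<close> of multiples of \<open>l\<close> and \<open>a\<close> copies of one size \<open>b\<close>, with \<open>\<Sum>D + a * b = n\<close>. Exchanging \<open>a\<close>
  and \<open>b\<close> pairs these partitions off (conjugation of the rectangle \<open>a \<times> b\<close>), unless \<open>a = b\<close>; but
  \<open>a = b\<close> makes \<open>n\<close> congruent to \<open>a\<^sup>2\<close> modulo \<open>l\<close>. Hence 4 divides \<open>Rstar l n\<close> whenever \<open>n\<close> is not
  a square modulo \<open>l\<close>. Since 2 and 3 are not squares modulo 5, the numbers \<open>5 * n + 2\<close> and
  \<open>5 * n + 3\<close> are not squares modulo \<open>5 * k\<close>.
\<close>

section \<open>Counting the overlinings of a fixed partition\<close>

definition regular_sizes :: "nat \<Rightarrow> nat multiset \<Rightarrow> nat set" where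
  "regular_sizes l P = {m \<in> set_mset P. \<not> l dvd m}"

definition multiple_sizes :: "nat \<Rightarrow> nat multiset \<Rightarrow> nat set" where
  "multiple_sizes l P = {m \<in> set_mset P. l dvd m}"

definition distinct_multiples_partitions :: "nat \<Rightarrow> nat \<Rightarrow> nat multiset set" where
  "distinct_multiples_partitions l n =
     {P. is_partition n P \<and> (\<forall>m\<in>multiple_sizes l P. count P m = 1)}"

lemma finite_regular_sizes [simp]: "finite (regular_sizes l P)"
  by (simp add: regular_sizes_def)

lemma finite_multiple_sizes [simp]: "finite (multiple_sizes l P)"
  by (simp add: multiple_sizes_def)

lemma finite_distinct_multiples_partitions [simp]: "finite (distinct_multiples_partitions l n)"
proof (rule finite_subset)
  show "distinct_multiples_partitions l n \<subseteq> fst ` overpartitions n"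
    by (force simp: distinct_multiples_partitions_def overpartitions_def)
qed (simp add: finite_overpartitions)

lemma regular_nonoverlined_iff:
  assumes "S \<subseteq> set_mset P"
  shows "regular l (nonoverlined_parts (P, S)) \<longleftrightarrow>
           multiple_sizes l P \<subseteq> S \<and> (\<forall>m\<in>multiple_sizes l P. count P m = 1)"
proof -
  have "finite S"
    using assms by (rule finite_subset) simp
  then have "m \<in># P - mset_set S \<longleftrightarrow> m \<in># P \<and> \<not> (m \<in> S \<and> count P m = 1)" for m
    by (cases "m \<in> S") (auto simp: in_diff_count not_in_iff count_greater_zero_iff[symmetric]
        simp del: count_greater_zero_iff)
  then show ?thesis
    by (auto simp: regular_def nonoverlined_parts_def multiple_sizes_def)
qed

text \<open>The admissible overlinings contain all multiples of \<open>l\<close> and any subset of the other sizes.\<close>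

lemma card_overlinings:
  "card {S. multiple_sizes l P \<subseteq> S \<and> S \<subseteq> set_mset P} = 2 ^ card (regular_sizes l P)"
proof -
  have "bij_betw (\<lambda>S. S \<union> multiple_sizes l P) (Pow (regular_sizes l P))
          {S. multiple_sizes l P \<subseteq> S \<and> S \<subseteq> set_mset P}"
    by (rule bij_betw_byWitness[where f' = "\<lambda>S. S - multiple_sizes l P"])
      (auto simp: regular_sizes_def multiple_sizes_def)
  then show ?thesis
    by (metis bij_betw_same_card card_Pow finite_regular_sizes)
qed

lemma Rstar_eq_sum:
  "Rstar l n = (\<Sum>P\<in>distinct_multiples_partitions l n. 2 ^ card (regular_sizes l P))"
proof -
  have "{p \<in> overpartitions n. regular l (nonoverlined_parts p)} =
          Sigma (distinct_multiples_partitions l n)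
            (\<lambda>P. {S. multiple_sizes l P \<subseteq> S \<and> S \<subseteq> set_mset P})"
    by (auto simp: overpartitions_def regular_nonoverlined_iff distinct_multiples_partitions_def)
  moreover have "finite {S. multiple_sizes l P \<subseteq> S \<and> S \<subseteq> set_mset P}" for P
    by (rule finite_subset[of _ "Pow (set_mset P)"]) auto
  ultimately show ?thesis
    by (simp add: Rstar_def card_SigmaI card_overlinings)
qed

section \<open>Reduction modulo 2 and modulo 4\<close>

lemma card_regular_sizes_pos:
  assumes "is_partition n P" "\<not> l dvd n"
  shows "card (regular_sizes l P) \<ge> 1"
proof -
  have "regular_sizes l P \<noteq> {}"
  proof
    assume "regular_sizes l P = {}"
    then have "\<forall>m\<in>#P. l dvd m"
      by (auto simp: regular_sizes_def)
    then have "l dvd sum_mset P"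
      by (induction P) auto
    with assms show False
      by (simp add: is_partition_def)
  qed
  then show ?thesis
    by (simp add: Suc_le_eq card_gt_0_iff)
qed

theorem even_Rstar:
  assumes "\<not> l dvd n"
  shows "even (Rstar l n)"
  unfolding Rstar_eq_sum
  by (rule dvd_sum)
    (use assms in \<open>auto simp: distinct_multiples_partitions_def Suc_le_eq
      dest!: card_regular_sizes_pos\<close>)

lemma sum_power_2_cong_4:
  fixes c :: "'a \<Rightarrow> nat"
  assumes "finite A" "\<And>x. x \<in> A \<Longrightarrow> c x \<ge> 1"
  shows "[(\<Sum>x\<in>A. 2 ^ c x) = 2 * card {x \<in> A. c x = 1}] (mod (4::nat))"
proof -
  have "[2 ^ c x = (if c x = 1 then 2 else 0)] (mod (4::nat))" if "x \<in> A" for x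
  proof (cases "c x = 1")
    case False
    with assms(2)[OF that] have "2 \<le> c x"
      by simp
    then have "(2::nat) ^ 2 dvd 2 ^ c x"
      by (rule le_imp_power_dvd)
    with False show ?thesis
      by (simp add: cong_0_iff)
  qed simp
  then have "[(\<Sum>x\<in>A. 2 ^ c x) = (\<Sum>x\<in>A. if c x = 1 then 2 else 0)] (mod (4::nat))"
    by (rule cong_sum)
  also have "(\<Sum>x\<in>A. if c x = 1 then 2 else 0) = 2 * card {x \<in> A. c x = 1}"
    using assms(1) by (simp add: sum.If_cases Int_def)
  finally show ?thesis .
qed

section \<open>Partitions with a single size that is not a multiple of l\<close>

text \<open>
  A triple \<open>(D, a, b)\<close> encodes the partition made of the elements of \<open>D\<close> and \<open>a\<close> copies of \<open>b\<close>.
  The conditions are symmetric in \<open>a\<close> and \<open>b\<close>, which is what the pairing relies on.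
\<close>

definition rectangle_triples :: "nat \<Rightarrow> nat \<Rightarrow> (nat set \<times> nat \<times> nat) set" where
  "rectangle_triples l n =
     {(D, a, b). finite D \<and> 0 \<notin> D \<and> (\<forall>d\<in>D. l dvd d) \<and> \<Sum>D + a * b = n}"

lemma rectangle_triples_not_dvd:
  assumes "(D, a, b) \<in> rectangle_triples l n" "\<not> l dvd n"
  shows "\<not> l dvd a" "\<not> l dvd b" "a > 0"
proof -
  have "l dvd \<Sum>D"
    using assms(1) by (auto simp: rectangle_triples_def intro: dvd_sum)
  then have "\<not> l dvd a * b"
    using assms by (auto simp: rectangle_triples_def)
  then show "\<not> l dvd a" "\<not> l dvd b" "a > 0"
    by (auto intro!: gr0I)
qed

text \<open>
  The triple is recovered from its partition because \<open>a * b\<close> is congruent to \<open>n\<close> modulo \<open>l\<close>: as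
  \<open>l\<close> does not divide \<open>n\<close>, the size \<open>b\<close> is not a multiple of \<open>l\<close> and cannot collide with \<open>D\<close>, and
  \<open>a\<close> is nonzero, so that \<open>b\<close> does occur.
\<close>

lemma bij_betw_rectangle_triples:
  assumes "\<not> l dvd n"
  shows "bij_betw (\<lambda>(D, a, b). mset_set D + replicate_mset a b) (rectangle_triples l n)
           {P \<in> distinct_multiples_partitions l n. card (regular_sizes l P) = 1}"
proof -
  have parts: "multiple_sizes l (mset_set D + replicate_mset a b) = D"
      "regular_sizes l (mset_set D + replicate_mset a b) = {b}"
      "count (mset_set D + replicate_mset a b) b = a"
    if "(D, a, b) \<in> rectangle_triples l n" for D a b
    using that rectangle_triples_not_dvd[OF that assms]
    by (auto simp: rectangle_triples_def multiple_sizes_def regular_sizes_def)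
  have inj: "inj_on (\<lambda>(D, a, b). mset_set D + replicate_mset a b) (rectangle_triples l n)"
  proof (rule inj_on_inverseI)
    let ?b = "\<lambda>P. the_elem (regular_sizes l P)"
    show "(\<lambda>P. (multiple_sizes l P, count P (?b P), ?b P))
        ((\<lambda>(D, a, b). mset_set D + replicate_mset a b) t) = t"
      if "t \<in> rectangle_triples l n" for t
    proof (cases t)
      case (fields D a b)
      with that show ?thesis
        using parts[of D a b] by (simp del: count_union)
    qed
  qed
  have into: "mset_set D + replicate_mset a b
      \<in> {P \<in> distinct_multiples_partitions l n. card (regular_sizes l P) = 1}"
    if t: "(D, a, b) \<in> rectangle_triples l n" for D a b
  proof -
    have "finite D" "0 \<notin> D" "\<forall>d\<in>D. l dvd d" "\<Sum>D + a * b = n"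
      using t by (auto simp: rectangle_triples_def)
    moreover have "\<not> l dvd b"
      using rectangle_triples_not_dvd[OF t assms] by simp
    ultimately show ?thesis
      using parts[OF t]
      by (auto simp: distinct_multiples_partitions_def is_partition_def sum_unfold_sum_mset)
  qed
  have onto: "P \<in> (\<lambda>(D, a, b). mset_set D + replicate_mset a b) ` rectangle_triples l n"
    if P: "P \<in> distinct_multiples_partitions l n" "card (regular_sizes l P) = 1" for P
  proof -
    obtain b where b: "regular_sizes l P = {b}"
      using P(2) by (auto simp: card_1_singleton_iff)
    define D where "D = multiple_sizes l P"
    have "count P m = count (mset_set D + replicate_mset (count P b) b) m" for m
    proof (cases "m \<in># P")
      case True
      then have "m \<in> D \<and> m \<noteq> b \<or> m \<notin> D \<and> m = b"
        using b by (auto simp: D_def multiple_sizes_def regular_sizes_def)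
      with P(1) show ?thesis
        by (auto simp: D_def distinct_multiples_partitions_def)
    next
      case False
      then show ?thesis
        by (auto simp: D_def multiple_sizes_def not_in_iff)
    qed
    then have P_eq: "P = mset_set D + replicate_mset (count P b) b"
      by (rule multiset_eqI)
    have "finite D" "\<forall>d\<in>D. l dvd d"
      by (auto simp: D_def multiple_sizes_def)
    moreover have "0 \<notin> D"
      using P(1) by (auto simp: D_def multiple_sizes_def distinct_multiples_partitions_def
          is_partition_def)
    moreover have "\<Sum>D + count P b * b = n"
    proof -
      have "n = sum_mset P"
        using P(1) by (simp add: distinct_multiples_partitions_def is_partition_def)
      also have "\<dots> = \<Sum>D + count P b * b"
        by (subst P_eq) (simp add: sum_unfold_sum_mset)
      finally show ?thesis
        by simp
    qed
    ultimately have "(D, count P b, b) \<in> rectangle_triples l n"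
      by (simp add: rectangle_triples_def)
    with P_eq show ?thesis
      by (auto intro!: rev_image_eqI)
  qed
  show ?thesis
    unfolding bij_betw_def using inj into onto by auto
qed

text \<open>
  Exchanging \<open>a\<close> and \<open>b\<close> matches the triples with \<open>a < b\<close> to those with \<open>b < a\<close>; a triple on the
  diagonal would exhibit \<open>n\<close> as a square modulo \<open>l\<close>.
\<close>

lemma even_card_rectangle_triples:
  assumes nonsquare: "\<And>x. \<not> [x ^ 2 = n] (mod l)"
    and finite: "finite (rectangle_triples l n)"
  shows "even (card (rectangle_triples l n))"
proof -
  define L where "L = {(D, a, b) \<in> rectangle_triples l n. a < b}"
  define G where "G = {(D, a, b) \<in> rectangle_triples l n. b < a}"
  have "a \<noteq> b" if "(D, a, b) \<in> rectangle_triples l n" for D a b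
  proof
    assume "a = b"
    with that have "l dvd \<Sum>D" and n: "n = \<Sum>D + a ^ 2"
      by (auto simp: rectangle_triples_def power2_eq_square intro: dvd_sum)
    then have "[n = 0 + a ^ 2] (mod l)"
      unfolding n by (intro cong_add) (simp_all add: cong_0_iff)
    with nonsquare[of a] show False
      by (simp add: cong_sym_eq)
  qed
  then have "rectangle_triples l n = L \<union> G"
    by (auto simp: L_def G_def neq_iff)
  moreover have "L \<inter> G = {}"
    by (auto simp: L_def G_def)
  ultimately have "card (rectangle_triples l n) = card L + card G"
    using finite by (simp add: card_Un_disjoint)
  moreover have "bij_betw (\<lambda>(D, a, b). (D, b, a)) L G"
    by (rule bij_betw_byWitness[where f' = "\<lambda>(D, a, b). (D, b, a)"])
      (auto simp: L_def G_def rectangle_triples_def mult.commute)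
  ultimately show ?thesis
    by (simp add: bij_betw_same_card)
qed

section \<open>Divisibility by 4\<close>

theorem four_dvd_Rstar:
  assumes nonsquare: "\<And>x. \<not> [x ^ 2 = n] (mod l)"
  shows "4 dvd Rstar l n"
proof -
  let ?A = "distinct_multiples_partitions l n"
  let ?B = "{P \<in> ?A. card (regular_sizes l P) = 1}"
  \<comment> \<open>Zero is a square, so a nonsquare is not a multiple of \<open>l\<close>.\<close>
  have l: "\<not> l dvd n"
    using nonsquare[of 0] cong_sym[of n 0 l] by (auto simp: cong_0_iff)
  note bij = bij_betw_rectangle_triples[OF l]
  have "finite (rectangle_triples l n)"
    using bij_betw_finite[OF bij] by simp
  then have "even (card ?B)"
    using even_card_rectangle_triples[OF nonsquare] bij_betw_same_card[OF bij] by simp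
  then have "4 dvd 2 * card ?B"
    by auto
  moreover have "[Rstar l n = 2 * card ?B] (mod 4)"
    unfolding Rstar_eq_sum
  proof (rule sum_power_2_cong_4)
    show "card (regular_sizes l P) \<ge> 1" if "P \<in> ?A" for P
      using that l by (intro card_regular_sizes_pos) (auto simp: distinct_multiples_partitions_def)
  qed simp
  ultimately show ?thesis
    by (simp add: cong_dvd_iff)
qed

lemma square_mod_5: "x ^ 2 mod 5 \<in> {0, 1, 4 :: nat}"
proof -
  have "x mod 5 \<in> {0, 1, 2, 3, 4}"
    by auto
  then have "(x mod 5) ^ 2 mod 5 \<in> {0, 1, 4 :: nat}"
    by auto
  then show ?thesis
    by (simp add: power_mod)
qed

theorem theorem3p2:
  fixes k n :: nat
  assumes "k > 0"
  shows "(\<forall>\<xi>\<in>{2, 3}. [Rstar (5 * k) (5 * n + \<xi>) = 0] (mod 4)) \<and>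
         [Rstar (5 * k) (5 * n + 1) = 0] (mod 2)"
proof
  show "\<forall>\<xi>\<in>{2, 3}. [Rstar (5 * k) (5 * n + \<xi>) = 0] (mod 4)"
  proof
    fix \<xi> :: nat
    assume \<xi>: "\<xi> \<in> {2, 3}"
    have "\<not> [x ^ 2 = 5 * n + \<xi>] (mod 5 * k)" for x
    proof
      assume "[x ^ 2 = 5 * n + \<xi>] (mod 5 * k)"
      then have "[x ^ 2 = 5 * n + \<xi>] (mod 5)"
        by (rule cong_dvd_modulus_nat) simp
      then show False
        using square_mod_5[of x] \<xi> by (auto simp: cong_def)
    qed
    then show "[Rstar (5 * k) (5 * n + \<xi>) = 0] (mod 4)"
      by (simp add: cong_0_iff four_dvd_Rstar)
  qed
  have "\<not> 5 dvd 5 * n + 1"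
    by presburger
  then have "\<not> 5 * k dvd 5 * n + 1"
    using dvd_mult_left by blast
  then show "[Rstar (5 * k) (5 * n + 1) = 0] (mod 2)"
    unfolding cong_0_iff by (rule even_Rstar)
qed

end
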